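(* Let $X\subset\mathbb{R}^2$ be a compact real algebraic curve with a single component (its normalization has source $S^1$). For any $u\notin\Delta_{tED}$, let $N(u)$, $M(u)$, $m(u)$ be the numbers of critical points, maxima and minima of $\mathbb{D}_u$; let $M_{\prec}(u)$, $m_{\prec}(u)$ be the numbers of maxima and minima of $\mathbb{D}_u$ located at cuspidal points, and $N_{\prec}(u)$ the total number of cuspidal points. Then: - The total number of normals is $N(u)=M(u)+m(u)\ge 2$. - $m(u)=M(u)\geq 1$. - Each cuspidal point contributes to at least one normal: $$N(u)\ \ge\ M_{\prec}(u)+m_{\prec}(u)+|M_{\prec}(u)-m_{\prec}(u)|\ \ge\ N_{\prec}(u).$$
   Context: $X$ is a reduced real algebraic curve all of whose local branches are real and $1$-dimensional, and it is the image of its normalization $\gamma:S^1\to\mathbb{R}^2$. At each point a local branch is parametrized, in Euclidean coordinates with the point at the origin and the $x_1$-axis along the tangent line, by $x_1(t)=t^p$, $x_2(t)=c\,t^q+\sigma_{q+1}(t)$ with $q>p$, $c\neq0$, all terms of $\sigma_{q+1}$ of degree $>q$; the point is cuspidal (geometric singular) if $p$ is even. $\mathbb{D}_u(y)=|y-u|^2$ is considered on the normalization $S^1$; its (topological) critical points are the local maxima and minima (for $u\notin\Delta_{tED}$). Normals from $u$ are the intervals $[xu]$ with $x$ a critical point of $\mathbb{D}_u$: ordinary normals if $x$ is a smooth point, s-normals if $x$ is a geometric singular point; so $N(u)$ counts all normals through $u$. A point $u$ is topologically stable if $\mathbb{D}_v$ is topologically equivalent to $\mathbb{D}_u$ for all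 $v$ in a neighborhood of $u$ (the topological type being determined by the numbers of maxima and minima on the normalization); $\Delta_{tED}$ is the complement of the set of stable points. Every cuspidal point is a critical point of $\mathbb{D}_u$ for every $u\notin\Delta_{tED}$. *)

theory Defs
  imports
    "HOL-Analysis.Analysis"
    "HOL-Computational_Algebra.Computational_Algebra"
    "HOL-Library.Equipollence"
begin

section \<open>Plane algebraic curves with real equation\<close>

text \<open>
  A bivariate polynomial is an element of \<open>\<real>[x\<^sub>1][x\<^sub>2]\<close>: the outer variable
  is the second coordinate. The point may be real or complex.
\<close>

definition eval2 :: "real poly poly \<Rightarrow> ('a::{comm_ring_1,real_algebra_1})^2 \<Rightarrow> 'a" where
  "eval2 P v = poly (poly (map_poly (map_poly of_real) P) [:v $ 2:]) (v $ 1)"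

definition zero_locus :: "real poly poly \<Rightarrow> (('a::{comm_ring_1,real_algebra_1})^2) set" where
  "zero_locus P = {v. eval2 P v = 0}"

definition complexify :: "real^2 \<Rightarrow> complex^2" where
  "complexify v = (\<chi> i. of_real (v $ i))"

section \<open>Normalization\<close>

abbreviation S1 :: "complex set" where
  "S1 \<equiv> sphere 0 1"

text \<open>
  \<open>\<Gamma> : U \<rightarrow> V \<inter> W\<close> is the normalization of the part of the reduced complex curve
  \<open>V = {P = 0}\<close> lying in the open set \<open>W\<close>: the source is smooth, the map is holomorphic,
  finite (proper, with finite fibres), surjective, and bijective away from finitely many points.
\<close>

definition is_normalization ::
    "real poly poly \<Rightarrow> (complex^2) set \<Rightarrow> complex set \<Rightarrow> (complex \<Rightarrow> complex^2) \<Rightarrow> bool" where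
  "is_normalization P W U \<Gamma> \<longleftrightarrow>
     open U \<and> open W \<and>
     (\<forall>i. (\<lambda>z. \<Gamma> z $ i) holomorphic_on U) \<and>
     \<Gamma> ` U = zero_locus P \<inter> W \<and>
     proper_map (top_of_set U) (top_of_set (zero_locus P \<inter> W)) \<Gamma> \<and>
     (\<exists>S. finite S \<and> inj_on \<Gamma> (U - S))"

text \<open>
  \<open>\<gamma> : S\<^sup>1 \<rightarrow> \<real>\<^sup>2\<close> is the normalization of the real curve \<open>{P = 0}\<close>: it is the real part
  of the normalization \<open>\<Gamma>\<close> of the complexified curve in a neighbourhood of its real points.
  The points of \<open>U\<close> over a real point \<open>x\<close> of the curve are the local (complex) branches at \<open>x\<close>.
  The last but one conjunct says that these all belong to the circle, on which \<open>\<Gamma>\<close> takes real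
  values: all local branches at real points are real and one-dimensional.
\<close>

definition normalized_by_circle :: "real poly poly \<Rightarrow> (complex \<Rightarrow> real^2) \<Rightarrow> bool" where
  "normalized_by_circle P \<gamma> \<longleftrightarrow>
     (\<exists>W U \<Gamma>.
        is_normalization P W U \<Gamma> \<and>
        complexify ` zero_locus P \<subseteq> W \<and>
        S1 \<subseteq> U \<and>
        {z \<in> U. \<Gamma> z \<in> range complexify} = S1 \<and>
        (\<forall>z\<in>S1. \<Gamma> z = complexify (\<gamma> z)))"

section \<open>Local branches and cuspidal points\<close>

text \<open>
  The branch of \<open>\<gamma>\<close> at \<open>z\<close> has the form \<open>x\<^sub>1 = t\<^sup>p\<close>, \<open>x\<^sub>2 = c t\<^sup>q + \<sigma>(t)\<close>, with \<open>\<sigma>\<close> of order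
  \<open>> q\<close>, in the Euclidean coordinates with origin \<open>\<gamma> z\<close> and axes \<open>e\<^sub>1\<close> (tangent) and \<open>e\<^sub>2\<close>.
  The real-analytic coordinate \<open>t\<close> of \<open>S\<^sup>1\<close> at \<open>z\<close> is given by \<open>t \<mapsto> z * cis (\<omega> t)\<close>
  with \<open>\<omega> 0 = 0\<close> and \<open>\<omega>' 0 \<noteq> 0\<close>.
\<close>

definition branch_form :: "(complex \<Rightarrow> real^2) \<Rightarrow> complex \<Rightarrow> nat \<Rightarrow> nat \<Rightarrow> real \<Rightarrow> bool" where
  "branch_form \<gamma> z p q c \<longleftrightarrow>
     1 \<le> p \<and> p < q \<and> c \<noteq> 0 \<and>
     (\<exists>e\<^sub>1 e\<^sub>2 :: real^2. \<exists>\<omega> A \<sigma> B.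
        norm e\<^sub>1 = 1 \<and> norm e\<^sub>2 = 1 \<and> e\<^sub>1 \<bullet> e\<^sub>2 = 0 \<and>
        \<omega> has_fps_expansion A \<and> fps_nth A 0 = 0 \<and> fps_nth A 1 \<noteq> 0 \<and>
        \<sigma> has_fps_expansion B \<and> (\<forall>n\<le>q. fps_nth B n = 0) \<and>
        (\<forall>\<^sub>F t in nhds 0. \<gamma> (z * cis (\<omega> t)) =
            \<gamma> z + t ^ p *\<^sub>R e\<^sub>1 + (c * t ^ q + \<sigma> t) *\<^sub>R e\<^sub>2))"

definition cuspidal_points :: "(complex \<Rightarrow> real^2) \<Rightarrow> complex set" where
  "cuspidal_points \<gamma> = {z \<in> S1. \<exists>p q c. branch_form \<gamma> z p q c \<and> even p}"

section \<open>Squared distance functions and their critical points\<close>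

definition sq_dist :: "real^2 \<Rightarrow> real^2 \<Rightarrow> real" where
  "sq_dist u y = (norm (y - u))\<^sup>2"

definition local_maxima :: "(complex \<Rightarrow> real) \<Rightarrow> complex set" where
  "local_maxima f = {z \<in> S1. \<forall>\<^sub>F w in at z within S1. f w \<le> f z}"

definition local_minima :: "(complex \<Rightarrow> real) \<Rightarrow> complex set" where
  "local_minima f = {z \<in> S1. \<forall>\<^sub>F w in at z within S1. f z \<le> f w}"

definition maxima :: "(complex \<Rightarrow> real^2) \<Rightarrow> real^2 \<Rightarrow> complex set" where
  "maxima \<gamma> u = local_maxima (sq_dist u \<circ> \<gamma>)"

definition minima :: "(complex \<Rightarrow> real^2) \<Rightarrow> real^2 \<Rightarrow> complex set" where
  "minima \<gamma> u = local_minima (sq_dist u \<circ> \<gamma>)"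

definition critical_points :: "(complex \<Rightarrow> real^2) \<Rightarrow> real^2 \<Rightarrow> complex set" where
  "critical_points \<gamma> u = maxima \<gamma> u \<union> minima \<gamma> u"

section \<open>Topological stability\<close>

text \<open>
  The topological type of a function on the circle is given by its numbers of local maxima and
  of local minima; equipollence keeps infinite numbers apart from finite ones. This is implied
  by left-right topological equivalence, see below.
\<close>

definition topologically_equivalent :: "(complex \<Rightarrow> real) \<Rightarrow> (complex \<Rightarrow> real) \<Rightarrow> bool" where
  "topologically_equivalent f g \<longleftrightarrow>
     local_maxima f \<approx> local_maxima g \<and> local_minima f \<approx> local_minima g"

lemma local_extrema_homeomorphism_transfer:
  assumes hom: "homeomorphism S1 S1 h h'" and k: "strict_mono k"
    and eq: "\<And>z. z \<in> S1 \<Longrightarrow> g (h z) = k (f z)"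
    and z: "z \<in> S1"
  shows "(h z \<in> local_maxima g) = (z \<in> local_maxima f)"
    and "(h z \<in> local_minima g) = (z \<in> local_minima f)"
proof -
  have hz: "h z \<in> S1" and h'h: "\<And>x. x \<in> S1 \<Longrightarrow> h' (h x) = x"
    and hh': "\<And>x. x \<in> S1 \<Longrightarrow> h (h' x) = x"
    and mem: "\<And>x. x \<in> S1 \<Longrightarrow> h x \<in> S1" "\<And>x. x \<in> S1 \<Longrightarrow> h' x \<in> S1"
    using hom z by (auto simp: homeomorphism_def)
  have lim_h: "filterlim h (at (h z) within S1) (at z within S1)"
  proof -
    have "(h \<longlongrightarrow> h z) (at z within S1)"
      using hom z by (auto simp: homeomorphism_def continuous_on_def)
    moreover have "\<forall>\<^sub>F w in at z within S1. h w \<in> S1 \<and> h w \<noteq> h z"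
      using mem(1) h'h z by (auto simp: eventually_at_filter intro!: always_eventually) (metis h'h)
    ultimately show ?thesis
      by (auto simp: filterlim_at)
  qed
  have lim_h': "filterlim h' (at z within S1) (at (h z) within S1)"
  proof -
    have "(h' \<longlongrightarrow> h' (h z)) (at (h z) within S1)"
      using hom hz by (auto simp: homeomorphism_def continuous_on_def)
    moreover have "\<forall>\<^sub>F w in at (h z) within S1. h' w \<in> S1 \<and> h' w \<noteq> z"
      using mem(2) hh' z by (auto simp: eventually_at_filter intro!: always_eventually)
    ultimately show ?thesis
      using h'h[OF z] by (auto simp: filterlim_at)
  qed
  have transfer: "(\<forall>\<^sub>F w in at (h z) within S1. Q w) = (\<forall>\<^sub>F w in at z within S1. Q (h w))" for Q
  proof
    assume "\<forall>\<^sub>F w in at (h z) within S1. Q w"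
    then show "\<forall>\<^sub>F w in at z within S1. Q (h w)"
      using lim_h by (auto simp: filterlim_iff)
  next
    assume "\<forall>\<^sub>F w in at z within S1. Q (h w)"
    then have "\<forall>\<^sub>F w in at (h z) within S1. Q (h (h' w))"
      using lim_h' unfolding filterlim_iff by blast
    moreover have "\<forall>\<^sub>F w in at (h z) within S1. w \<in> S1"
      by (simp add: eventually_at_filter)
    ultimately show "\<forall>\<^sub>F w in at (h z) within S1. Q w"
      by eventually_elim (metis hh')
  qed
  have "(\<forall>\<^sub>F w in at z within S1. g (h w) \<le> g (h z)) = (\<forall>\<^sub>F w in at z within S1. f w \<le> f z)"
    using k eq z by (auto simp: eventually_at_filter strict_mono_less_eq elim: eventually_mono)
  then show "(h z \<in> local_maxima g) = (z \<in> local_maxima f)"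
    using z hz transfer[of "\<lambda>w. g w \<le> g (h z)"] by (simp add: local_maxima_def)
  have "(\<forall>\<^sub>F w in at z within S1. g (h z) \<le> g (h w)) = (\<forall>\<^sub>F w in at z within S1. f z \<le> f w)"
    using k eq z by (auto simp: eventually_at_filter strict_mono_less_eq elim: eventually_mono)
  then show "(h z \<in> local_minima g) = (z \<in> local_minima f)"
    using z hz transfer[of "\<lambda>w. g (h z) \<le> g w"] by (simp add: local_minima_def)
qed

lemma topologically_equivalent_if_left_right_equivalent:
  assumes hom: "homeomorphism S1 S1 h h'" and k: "strict_mono k"
    and eq: "\<And>z. z \<in> S1 \<Longrightarrow> g (h z) = k (f z)"
  shows "topologically_equivalent f g"
proof -
  have im: "h ` S1 = S1" and "\<forall>z\<in>S1. h' (h z) = z"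
    using hom by (auto simp: homeomorphism_def)
  then have inj: "inj_on h S1"
    by (metis inj_on_inverseI)
  have bij: "bij_betw h A B"
    if "A \<subseteq> S1" "B \<subseteq> S1" and iff: "\<And>z. z \<in> S1 \<Longrightarrow> h z \<in> B \<longleftrightarrow> z \<in> A" for A B
  proof (rule bij_betw_imageI)
    show "inj_on h A"
      using inj that(1) by (rule inj_on_subset)
    show "h ` A = B"
    proof
      show "h ` A \<subseteq> B"
        using iff that(1) by auto
      show "B \<subseteq> h ` A"
      proof
        fix w assume w: "w \<in> B"
        with that(2) im obtain z where "z \<in> S1" "w = h z"
          by (metis imageE subsetD)
        with w iff show "w \<in> h ` A"
          by auto
      qed
    qed
  qed
  have "bij_betw h (local_maxima f) (local_maxima g)"
  proof (rule bij)
    show "h z \<in> local_maxima g \<longleftrightarrow> z \<in> local_maxima f" if "z \<in> S1" for z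
      using hom k eq that by (rule local_extrema_homeomorphism_transfer(1))
  qed (simp_all add: local_maxima_def subset_iff)
  moreover have "bij_betw h (local_minima f) (local_minima g)"
  proof (rule bij)
    show "h z \<in> local_minima g \<longleftrightarrow> z \<in> local_minima f" if "z \<in> S1" for z
      using hom k eq that by (rule local_extrema_homeomorphism_transfer(2))
  qed (simp_all add: local_minima_def subset_iff)
  ultimately show ?thesis
    by (auto simp: topologically_equivalent_def eqpoll_def)
qed

definition topologically_stable :: "(complex \<Rightarrow> real^2) \<Rightarrow> real^2 \<Rightarrow> bool" where
  "topologically_stable \<gamma> u \<longleftrightarrow>
     (\<forall>\<^sub>F v in nhds u. topologically_equivalent (sq_dist v \<circ> \<gamma>) (sq_dist u \<circ> \<gamma>))"

definition tED_discriminant :: "(complex \<Rightarrow> real^2) \<Rightarrow> (real^2) set" where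
  "tED_discriminant \<gamma> = - {u. topologically_stable \<gamma> u}"

end

theory Submission
  imports Defs "HOL-Complex_Analysis.Conformal_Mappings"
begin

text \<open>
  The pullback of the squared distance to \<open>S\<^sup>1\<close> is the restriction of a holomorphic function.
  Stability forbids it to be constant: moving \<open>u\<close> in the direction of a chord makes it
  nonconstant, and nonconstant pullbacks have only finitely many local extrema by the identity
  theorem. Finitely many local extrema on a circle are strict, and maxima and minima alternate.

  A local extremum persists under small perturbations of \<open>u\<close>. Hence if a point is not extremal
  for a stable \<open>u\<close>, it is not extremal for any nearby \<open>v\<close> either, because the number of maxima or
  of minima would go up. A cuspidal point is extremal for every \<open>v\<close> off its normal line, so it is
  extremal for every stable \<open>u\<close>, and \<open>N = 2 M = 2 m \<ge> 2 max M\<^sub>c m\<^sub>c \<ge> M\<^sub>c + m\<^sub>c = N\<^sub>c\<close>.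
\<close>

section \<open>The circle in the angular coordinate\<close>

lemma cis_inj_on_period:
  assumes "cis a = cis b" "\<bar>a - b\<bar> < 2 * pi"
  shows "a = b"
  using exp_complex_eqI[of "\<i> * of_real a" "\<i> * of_real b"] assms by (simp add: cis_conv_exp)

text \<open>This turns local statements on the circle into statements about one real variable near
  0. The two inclusions are two limits, those of \<open>s \<mapsto> z * cis s\<close> and of its
  local inverse \<open>w \<mapsto> Arg (w / z)\<close>, each avoiding its own limit point.\<close>

lemma at_within_S1_eq_filtermap:
  assumes z: "z \<in> S1"
  shows "at z within S1 = filtermap (\<lambda>s. z * cis s) (at 0)"
proof (rule antisym)
  have z0: "z \<noteq> 0" using z by auto
  show "filtermap (\<lambda>s. z * cis s) (at 0) \<le> at z within S1"
  proof -
    have "((\<lambda>s. z * cis s) \<longlongrightarrow> z * cis 0) (at 0)"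
      by (intro tendsto_intros)
    moreover have circ: "z * cis s \<in> S1 \<and> z * cis s \<noteq> z" if "s \<noteq> 0" "\<bar>s\<bar> < 2 * pi" for s
      using that cis_inj_on_period[of s 0] z z0 by (auto simp: norm_mult)
    moreover have "\<forall>\<^sub>F s in at (0::real). s \<in> ball 0 (2 * pi) \<and> s \<noteq> 0 \<and> s \<in> UNIV"
      by (rule eventually_at_ball') simp
    then have "\<forall>\<^sub>F s in at 0. z * cis s \<in> S1 \<and> z * cis s \<noteq> z"
      by eventually_elim (rule circ, auto)
    ultimately have "filterlim (\<lambda>s. z * cis s) (at z within S1) (at 0)"
      by (auto simp: filterlim_at)
    then show ?thesis by (simp add: filterlim_def)
  qed
  have eq: "z * cis (Arg (w / z)) = w" if "w \<in> S1" for w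
    using that z z0 by (subst cis_Arg) (auto simp: sgn_div_norm norm_divide)
  \<comment> \<open>Dividing by \<open>z\<close> moves the base point to 1, away from the branch cut
    of \<open>Arg\<close>.\<close>
  have "((\<lambda>w. Arg (w / z)) \<longlongrightarrow> Arg (z / z)) (at z within S1)"
    using z0 by (intro tendsto_intros) auto
  moreover have "\<forall>\<^sub>F w in at z within S1. Arg (w / z) \<noteq> 0"
    unfolding eventually_at_filter
  proof (intro always_eventually allI impI notI)
    fix w assume "w \<noteq> z" "w \<in> S1" "Arg (w / z) = 0"
    then show False using eq[of w] by simp
  qed
  ultimately have lim: "filterlim (\<lambda>w. Arg (w / z)) (at 0) (at z within S1)"
    using z0 by (auto simp: filterlim_at)
  show "at z within S1 \<le> filtermap (\<lambda>s. z * cis s) (at 0)"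
  proof (rule filter_leI)
    fix P assume "eventually P (filtermap (\<lambda>s. z * cis s) (at 0))"
    then have "\<forall>\<^sub>F s in at 0. P (z * cis s)" by (simp add: eventually_filtermap)
    then have "\<forall>\<^sub>F w in at z within S1. P (z * cis (Arg (w / z)))"
      using lim by (rule eventually_compose_filterlim)
    moreover have "\<forall>\<^sub>F w in at z within S1. w \<in> S1"
      by (simp add: eventually_at_filter)
    ultimately show "eventually P (at z within S1)"
      by eventually_elim (simp only: eq)
  qed
qed

lemma eventually_at_S1_iff:
  assumes "z \<in> S1"
  shows "(\<forall>\<^sub>F w in at z within S1. Q w) \<longleftrightarrow> (\<forall>\<^sub>F s in at 0. Q (z * cis s))"
  by (simp add: at_within_S1_eq_filtermap[OF assms] eventually_filtermap)

lemma eventually_at_S1_cis_iff: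
  "(\<forall>\<^sub>F w in at (cis a) within S1. Q w) \<longleftrightarrow> (\<forall>\<^sub>F t in at a. Q (cis t))"
  by (simp add: eventually_at_S1_iff cis_mult eventually_at_to_0[of _ a] add.commute)

lemma at_within_S1_neq_bot:
  assumes "z \<in> S1"
  shows "at z within S1 \<noteq> bot"
  by (simp add: at_within_S1_eq_filtermap[OF assms] filtermap_bot_iff)

lemma infinite_S1: "infinite S1"
proof
  assume "finite S1"
  then have "\<not> 1 islimpt S1" using islimpt_finite by blast
  then show False using at_within_S1_neq_bot[of 1] trivial_limit_within[of 1 S1] by auto
qed

section \<open>Strictness and alternation of local extrema on the circle\<close>

lemma local_maxima_uminus [simp]: "local_maxima (\<lambda>z. - f z) = local_minima f"
  by (auto simp: local_maxima_def local_minima_def)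

lemma local_minima_uminus [simp]: "local_minima (\<lambda>z. - f z) = local_maxima f"
  by (auto simp: local_maxima_def local_minima_def)

lemma eventually_at_in_open_within:
  assumes "open A" "x \<in> A"
  shows "\<forall>\<^sub>F w in at x within S. w \<in> A"
  unfolding eventually_at_filter
  by (rule eventually_mono[OF eventually_nhds_in_open[OF assms]]) simp

text \<open>A point near a local maximum with the same value is again a local maximum, so a
  non-strict local maximum is an accumulation point of local maxima.\<close>

lemma strict_local_maximum:
  assumes fin: "finite (local_maxima f)" and z: "z \<in> local_maxima f"
  shows "\<forall>\<^sub>F w in at z within S1. f w < f z"
proof -
  have "\<forall>\<^sub>F w in at z within S1. f w \<le> f z"
    using z by (simp add: local_maxima_def)
  then obtain d where d: "d > 0"
    and le: "\<And>w. w \<in> S1 \<Longrightarrow> w \<noteq> z \<Longrightarrow> dist w z < d \<Longrightarrow> f w \<le> f z"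
    by (auto simp: eventually_at)
  obtain d' where d': "d' > 0" and far: "\<And>w. w \<in> local_maxima f \<Longrightarrow> w \<noteq> z \<Longrightarrow> d' \<le> dist z w"
    using finite_set_avoid[OF fin, of z] by blast
  show ?thesis
    unfolding eventually_at
  proof (intro exI[of _ "min d d'"] conjI ballI impI)
    fix w assume w: "w \<in> S1" "w \<noteq> z \<and> dist w z < min d d'"
    have "f w \<noteq> f z"
    proof
      assume eq: "f w = f z"
      have "\<forall>\<^sub>F x in at w within S1. x \<in> ball z d"
        using w by (intro eventually_at_in_open_within) (auto simp: dist_commute)
      moreover have "\<forall>\<^sub>F x in at w within S1. x \<in> S1"
        by (simp add: eventually_at_filter)
      ultimately have "\<forall>\<^sub>F x in at w within S1. f x \<le> f w"
        by eventually_elim (metis eq le dist_commute mem_ball order_refl)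
      then have "w \<in> local_maxima f" using w by (simp add: local_maxima_def)
      then show False using far[of w] w by (simp add: dist_commute)
    qed
    with le[of w] w show "f w < f z" by simp
  qed (use d d' in auto)
qed

text \<open>Choosing a point of \<open>B\<close> between each \<open>a\<close> and its successor is
  injective, because these gaps are disjoint. The extra point \<open>p\<close> is the successor of
  the largest element, so that the last gap is not lost.\<close>

lemma card_le_if_interlaced:
  fixes A B :: "real set"
  assumes fin: "finite A" "finite B" and p: "\<And>a. a \<in> A \<Longrightarrow> a < p"
    and btw: "\<And>a b. a \<in> A \<Longrightarrow> b \<in> insert p A \<Longrightarrow> a < b \<Longrightarrow> \<exists>c\<in>B. a < c \<and> c < b"
  shows "card A \<le> card B"
proof -
  define next_pt where "next_pt a = Min {b \<in> insert p A. a < b}" for a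
  have nxt: "next_pt a \<in> insert p A \<and> a < next_pt a" 
    and nxt_le: "\<And>b. b \<in> A \<Longrightarrow> a < b \<Longrightarrow> next_pt a \<le> b" if "a \<in> A" for a
  proof -
    have "next_pt a \<in> {b \<in> insert p A. a < b}"
      unfolding next_pt_def using fin p that by (intro Min_in) auto
    then show "next_pt a \<in> insert p A \<and> a < next_pt a" by simp
    show "next_pt a \<le> b" if "b \<in> A" "a < b" for b
      unfolding next_pt_def using fin that by (intro Min_le) auto
  qed
  have "\<forall>a\<in>A. \<exists>c\<in>B. a < c \<and> c < next_pt a"
    using btw nxt by blast
  then obtain h where h: "\<And>a. a \<in> A \<Longrightarrow> h a \<in> B \<and> a < h a \<and> h a < next_pt a"
    by metis
  have "inj_on h A"
  proof (rule linorder_inj_onI)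
    fix a b assume "a < b" "a \<in> A" "b \<in> A"
    then show "h a \<noteq> h b" using h[of a] h[of b] nxt_le[of a b] by force
  qed auto
  then show ?thesis
    using h fin by (intro card_inj_on_le) auto
qed

text \<open>The minimum over the closed interval cannot be at an end: strictness of the two maxima
  gives smaller values just inside. It is therefore interior and local. The interval may wind once
  around the circle, with both ends over the same maximum.\<close>

lemma local_minimum_between:
  assumes f: "continuous_on S1 f" and fin: "finite (local_maxima f)"
    and "cis a \<in> local_maxima f" "cis b \<in> local_maxima f" and ab: "a < b"
  shows "\<exists>c. a < c \<and> c < b \<and> cis c \<in> local_minima f"
proof -
  define g where "g = (\<lambda>t. f (cis t))"
  have cont: "continuous_on {a..b} g"
    unfolding g_def by (rule continuous_on_compose2[OF f]) (auto intro!: continuous_intros)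
  have str: "\<forall>\<^sub>F t in at a. g t < g a" "\<forall>\<^sub>F t in at b. g t < g b"
    using strict_local_maximum[OF fin assms(3)] strict_local_maximum[OF fin assms(4)]
    by (simp_all add: eventually_at_S1_cis_iff g_def)
  obtain c where c: "c \<in> {a..b}" "\<And>t. t \<in> {a..b} \<Longrightarrow> g c \<le> g t"
    using continuous_attains_inf[OF _ _ cont] ab by (auto simp del: atLeastAtMost_iff) 
  have "\<forall>\<^sub>F t in at_right a. g t < g a \<and> t \<in> {a<..<b}"
    using str(1) ab by (intro eventually_conj eventually_at_right_real) (auto simp: eventually_at_split)
  then obtain t1 where "g t1 < g a" "t1 \<in> {a<..<b}"
    using eventually_happens'[OF trivial_limit_at_right_real] by blast
  then have "c \<noteq> a" using c(2)[of t1] by auto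
  have "\<forall>\<^sub>F t in at_left b. g t < g b \<and> t \<in> {a<..<b}"
    using str(2) ab by (intro eventually_conj eventually_at_left_real) (auto simp: eventually_at_split)
  then obtain t2 where "g t2 < g b" "t2 \<in> {a<..<b}"
    using eventually_happens'[OF trivial_limit_at_left_real] by blast
  then have "c \<noteq> b" using c(2)[of t2] by auto
  with \<open>c \<noteq> a\<close> c(1) have cab: "a < c" "c < b" by auto
  then have "\<forall>\<^sub>F t in at c. t \<in> {a<..<b}"
    by (intro eventually_at_in_open') auto
  then have "\<forall>\<^sub>F t in at c. g c \<le> g t"
    by eventually_elim (simp add: c(2))
  then have "cis c \<in> local_minima f"
    by (simp add: local_minima_def eventually_at_S1_cis_iff g_def)
  with cab show ?thesis by blast
qed

text \<open>The circle is cut open at a maximum \<open>z0\<close>, so both ends of the period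
  represent \<open>z0\<close>. The gap after the last maximum thus also ends at a maximum and
  contains a minimum, and no gap is lost at the cut.\<close>

lemma card_local_maxima_le_card_local_minima:
  assumes f: "continuous_on S1 f" and fin: "finite (local_maxima f)" "finite (local_minima f)"
  shows "card (local_maxima f) \<le> card (local_minima f)"
proof (cases "local_maxima f = {}")
  case False
  then obtain z0 where z0: "z0 \<in> local_maxima f" by blast
  define \<alpha> where "\<alpha> = Arg z0"
  have S1: "local_maxima f \<subseteq> S1" "local_minima f \<subseteq> S1"
    by (auto simp: local_maxima_def local_minima_def)
  have \<alpha>: "cis \<alpha> = z0"
    using z0 S1 by (subst \<alpha>_def, subst cis_Arg) (auto simp: sgn_div_norm)
  define A where "A = {t \<in> {\<alpha>..<\<alpha> + 2 * pi}. cis t \<in> local_maxima f}"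
  define B where "B = {t \<in> {\<alpha>..<\<alpha> + 2 * pi}. cis t \<in> local_minima f}"
  have inj: "inj_on cis {\<alpha>..<\<alpha> + 2 * pi}"
    by (rule inj_onI) (auto intro!: cis_inj_on_period)
  have surj: "\<exists>t\<in>{\<alpha>..<\<alpha> + 2 * pi}. cis t = w" if "w \<in> S1" for w
  proof -
    have w: "cis (Arg w) = w" using that by (subst cis_Arg) (auto simp: sgn_div_norm)
    have "-pi < Arg w \<and> Arg w \<le> pi" "-pi < \<alpha> \<and> \<alpha> \<le> pi"
      by (simp_all add: Arg_bounded \<alpha>_def)
    \<comment> \<open>Both arguments lie in an interval of length \<open>2 * pi\<close>, so at most
      one shift by a period brings \<open>Arg w\<close> into the chosen window.\<close>
    then show ?thesis
      using w by (intro bexI[of _ "if Arg w < \<alpha> then Arg w + 2 * pi else Arg w"])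
        (auto simp flip: cis_mult)
  qed
  have bij: "bij_betw cis A (local_maxima f)" "bij_betw cis B (local_minima f)"
    using S1 surj unfolding A_def B_def
    by (auto intro!: bij_betw_imageI inj_on_subset[OF inj]; fastforce)+
  have "card A \<le> card B"
  proof (rule card_le_if_interlaced[where p = "\<alpha> + 2 * pi"])
    show "finite A" "finite B"
      using bij fin by (auto simp: bij_betw_finite)
    fix a b assume a: "a \<in> A" and b: "b \<in> insert (\<alpha> + 2 * pi) A" and "a < b"
    moreover have "cis b \<in> local_maxima f"
      using b \<alpha> z0 by (auto simp: A_def simp flip: cis_mult)
    ultimately obtain c where "a < c" "c < b" "cis c \<in> local_minima f"
      using local_minimum_between[OF f fin(1), of a b] by (auto simp: A_def)
    moreover from this have "c \<in> B"
      using a b by (auto simp: A_def B_def)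
    ultimately show "\<exists>c\<in>B. a < c \<and> c < b" by blast
  qed (auto simp: A_def)
  then show ?thesis
    using bij by (simp add: bij_betw_same_card)
qed simp

lemma card_local_maxima_eq_card_local_minima:
  assumes "continuous_on S1 f" "finite (local_maxima f)" "finite (local_minima f)"
  shows "card (local_maxima f) = card (local_minima f)"
  using card_local_maxima_le_card_local_minima[of f]
    card_local_maxima_le_card_local_minima[of "\<lambda>z. - f z"] assms
  by (simp add: continuous_on_minus)

lemma local_maxima_nonempty:
  assumes "continuous_on S1 f"
  shows "local_maxima f \<noteq> {}"
proof -
  obtain z where "z \<in> S1" "\<And>w. w \<in> S1 \<Longrightarrow> f w \<le> f z"
    using continuous_attains_sup[of S1 f] assms by force
  then have "z \<in> local_maxima f"
    by (auto simp: local_maxima_def eventually_at_filter)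
  then show ?thesis by blast
qed

text \<open>Finiteness makes the maximum strict, and strictness contradicts the minimum inequality
  because the punctured neighbourhoods in the circle are nonempty.\<close>

lemma local_maxima_inter_local_minima:
  assumes "finite (local_maxima f)"
  shows "local_maxima f \<inter> local_minima f = {}"
proof (rule ccontr)
  assume "\<not> ?thesis"
  then obtain z where z: "z \<in> local_maxima f" "z \<in> local_minima f" by blast
  then have "\<forall>\<^sub>F w in at z within S1. f w < f z \<and> f z \<le> f w"
    using strict_local_maximum[OF assms] by (simp add: local_minima_def eventually_conj_iff)
  then have "\<forall>\<^sub>F w in at z within S1. False"
    by eventually_elim auto
  then show False
    using at_within_S1_neq_bot[of z] z by (auto simp: local_minima_def trivial_limit_def)
qed

section \<open>Local maxima under uniformly small perturbations\<close>

text \<open>On the boundary of a small closed arc around \<open>z\<close> the values of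
  \<open>f\<close> stay at least \<open>2 * \<epsilon>\<close> below \<open>f z\<close>. A
  perturbation smaller than \<open>\<epsilon>\<close> keeps \<open>g z\<close> above the boundary
  values of \<open>g\<close>, so the maximum of \<open>g\<close> over the arc is attained in its
  interior and is a local maximum.\<close>

lemma local_maximum_persists:
  assumes f: "continuous_on S1 f" and fin: "finite (local_maxima f)"
    and z: "z \<in> local_maxima f" and r: "r > 0"
  shows "\<exists>\<epsilon>>0. \<forall>g. continuous_on S1 g \<longrightarrow> (\<forall>w\<in>S1. \<bar>g w - f w\<bar> < \<epsilon>) \<longrightarrow>
           (\<exists>z'\<in>local_maxima g. dist z z' < r)"
proof -
  have zS: "z \<in> S1" using z by (simp add: local_maxima_def)
  obtain d where d: "d > 0"
    and lt: "\<And>w. w \<in> S1 \<Longrightarrow> w \<noteq> z \<Longrightarrow> dist w z < d \<Longrightarrow> f w < f z"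
    using strict_local_maximum[OF fin z] by (auto simp: eventually_at)
  define \<rho> where "\<rho> = min r d / 2"
  have \<rho>: "\<rho> > 0" "\<rho> < r" "\<rho> < d" using r d by (auto simp: \<rho>_def)
  have "\<exists>\<epsilon>>0. \<forall>w\<in>S1 \<inter> sphere z \<rho>. f w + 2 * \<epsilon> \<le> f z"
  \<comment> \<open>For a radius above 2 the arc is the whole circle and has no boundary; then any
    positive constant will do.\<close>
  proof (cases "S1 \<inter> sphere z \<rho> = {}")
    case False
    have "continuous_on (S1 \<inter> sphere z \<rho>) f"
      using f by (rule continuous_on_subset) auto
    moreover have "compact (S1 \<inter> sphere z \<rho>)"
      by (intro compact_Int compact_sphere)
    ultimately obtain x where x: "x \<in> S1 \<inter> sphere z \<rho>" "\<And>w. w \<in> S1 \<inter> sphere z \<rho> \<Longrightarrow> f w \<le> f x"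
      using continuous_attains_sup[of "S1 \<inter> sphere z \<rho>" f] False by blast
    have "f x < f z" using x(1) \<rho> by (intro lt) (auto simp: dist_commute)
    moreover have "f w + 2 * ((f z - f x) / 2) \<le> f z" if "w \<in> S1 \<inter> sphere z \<rho>" for w
      using x(2)[OF that] by (simp add: field_simps)
    ultimately show ?thesis by (intro exI[of _ "(f z - f x) / 2"]) simp
  qed (auto intro: exI[of _ 1])
  then obtain \<epsilon> where \<epsilon>: "\<epsilon> > 0" "\<And>w. w \<in> S1 \<inter> sphere z \<rho> \<Longrightarrow> f w + 2 * \<epsilon> \<le> f z" by blast
  have "\<exists>z'\<in>local_maxima g. dist z z' < r"
    if g: "continuous_on S1 g" and close: "\<forall>w\<in>S1. \<bar>g w - f w\<bar> < \<epsilon>" for g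
  proof -
    have "continuous_on (S1 \<inter> cball z \<rho>) g"
      using g by (rule continuous_on_subset) auto
    moreover have "compact (S1 \<inter> cball z \<rho>)" by (intro compact_Int) auto
    moreover have zin: "z \<in> S1 \<inter> cball z \<rho>" using zS \<rho> by simp
    ultimately obtain y where y: "y \<in> S1 \<inter> cball z \<rho>" "\<And>w. w \<in> S1 \<inter> cball z \<rho> \<Longrightarrow> g w \<le> g y"
      using continuous_attains_sup[of "S1 \<inter> cball z \<rho>" g] by blast
    have "y \<notin> sphere z \<rho>"
    proof
      assume "y \<in> sphere z \<rho>"
      then have "f y + 2 * \<epsilon> \<le> f z" using y(1) \<epsilon>(2) by auto
      moreover have "\<bar>g y - f y\<bar> < \<epsilon>" "\<bar>g z - f z\<bar> < \<epsilon>" using close y(1) zS by auto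
      moreover have "g z \<le> g y" using y(2) zin by blast
      ultimately show False by linarith
    qed
    with y(1) have yb: "y \<in> S1" "y \<in> ball z \<rho>" by auto
    have "\<forall>\<^sub>F w in at y within S1. w \<in> ball z \<rho>"
      using yb(2) by (intro eventually_at_in_open_within) auto
    moreover have "\<forall>\<^sub>F w in at y within S1. w \<in> S1"
      by (simp add: eventually_at_filter)
    ultimately have "\<forall>\<^sub>F w in at y within S1. g w \<le> g y"
      by eventually_elim (auto intro!: y(2))
    then have "y \<in> local_maxima g" using yb by (simp add: local_maxima_def)
    moreover have "dist z y < r" using yb \<rho> by simp
    ultimately show ?thesis by blast
  qed
  with \<epsilon>(1) show ?thesis by blast
qed

text \<open>All old maxima persist, at distinct places and away from \<open>z0\<close>. If
  \<open>z0\<close> becomes a maximum as well, there are strictly more maxima than before.\<close>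

lemma new_local_maximum_not_eqpoll:
  assumes f: "continuous_on S1 f" and fin: "finite (local_maxima f)"
    and z0: "z0 \<notin> local_maxima f"
  shows "\<exists>\<epsilon>>0. \<forall>g. continuous_on S1 g \<longrightarrow> (\<forall>w\<in>S1. \<bar>g w - f w\<bar> < \<epsilon>) \<longrightarrow>
           z0 \<in> local_maxima g \<longrightarrow> \<not> local_maxima g \<approx> local_maxima f"
proof -
  define E where "E = insert z0 (local_maxima f)"
  have "finite E" using fin by (simp add: E_def)
  then have "\<forall>x. \<exists>d. d > 0 \<and> (\<forall>y\<in>E. y \<noteq> x \<longrightarrow> d \<le> dist x y)"
    using finite_set_avoid by blast
  from choice[OF this] obtain d where
    d: "\<forall>x. d x > 0 \<and> (\<forall>y\<in>E. y \<noteq> x \<longrightarrow> d x \<le> dist x y)"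
    by (rule exE)
  \<comment> \<open>Distinct points of \<open>E\<close> are at least \<open>2 * r\<close> apart, so
    the discs of radius \<open>r\<close> around them are disjoint. This gives injectivity of
    \<open>h\<close> below and keeps its values away from \<open>z0\<close>.\<close>
  define r where "r = Min (d ` E) / 2"
  have "E \<noteq> {}" by (simp add: E_def)
  then have r0: "r > 0" using \<open>finite E\<close> d by (simp add: r_def)
  have r_sep: "2 * r \<le> dist x y" if "x \<in> E" "y \<in> E" "x \<noteq> y" for x y
  proof -
    have "2 * r \<le> d x" using \<open>finite E\<close> that by (simp add: r_def)
    also have "d x \<le> dist x y" using d that by simp
    finally show ?thesis .
  qed
  note r = r0 r_sep
  have "\<forall>z\<in>local_maxima f. \<exists>\<epsilon>. \<epsilon> > 0 \<and> (\<forall>g. continuous_on S1 g \<longrightarrow>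
          (\<forall>w\<in>S1. \<bar>g w - f w\<bar> < \<epsilon>) \<longrightarrow> (\<exists>z'\<in>local_maxima g. dist z z' < r))"
    by (intro ballI local_maximum_persists[OF f fin _ r(1)])
  from bchoice[OF this] obtain e where e: "\<forall>z\<in>local_maxima f. e z > 0 \<and>
      (\<forall>g. continuous_on S1 g \<longrightarrow> (\<forall>w\<in>S1. \<bar>g w - f w\<bar> < e z) \<longrightarrow>
        (\<exists>z'\<in>local_maxima g. dist z z' < r))"
    by (rule exE)
  \<comment> \<open>The inserted 1 keeps the minimum meaningful without a separate argument that
    \<open>f\<close> has a maximum.\<close>
  define \<epsilon> where "\<epsilon> = Min (insert 1 (e ` local_maxima f))"
  have "\<epsilon> > 0" using fin e by (simp add: \<epsilon>_def)
  have \<epsilon>_le: "\<epsilon> \<le> e z" if "z \<in> local_maxima f" for z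
    using fin that by (simp add: \<epsilon>_def)
  have "\<not> local_maxima g \<approx> local_maxima f"
    if g: "continuous_on S1 g" and close: "\<forall>w\<in>S1. \<bar>g w - f w\<bar> < \<epsilon>"
      and z0g: "z0 \<in> local_maxima g" for g
  proof
    assume eqp: "local_maxima g \<approx> local_maxima f"
    then have fing: "finite (local_maxima g)"
      using fin eqpoll_finite_iff by blast
    have cardeq: "card (local_maxima g) = card (local_maxima f)"
      using eqp eqpoll_iff_card[OF fing fin] by blast
    have "\<exists>z'. z' \<in> local_maxima g \<and> dist z z' < r" if z: "z \<in> local_maxima f" for z
    proof -
      have "\<forall>w\<in>S1. \<bar>g w - f w\<bar> < e z"
        using close \<epsilon>_le[OF z] by force
      then have "\<exists>z'\<in>local_maxima g. dist z z' < r"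
        using bspec[OF e z] g by simp
      then show ?thesis by blast
    qed
    then obtain h where h: "\<And>z. z \<in> local_maxima f \<Longrightarrow> h z \<in> local_maxima g \<and> dist z (h z) < r"
      by metis
    have "inj_on h (local_maxima f)"
    proof (rule inj_onI, rule ccontr)
      fix x y assume x: "x \<in> local_maxima f" and y: "y \<in> local_maxima f" and "h x = h y" "x \<noteq> y"
      then have "dist x (h x) < r" "dist y (h x) < r" "2 * r \<le> dist x y"
        using h[OF x] h[OF y] r(2)[of x y] by (auto simp: E_def)
      then show False using dist_triangle2[of x y "h x"] by linarith
    qed
    moreover have "h ` local_maxima f \<subseteq> local_maxima g - {z0}"
    proof (rule image_subsetI)
      fix x assume x: "x \<in> local_maxima f"
      have "2 * r \<le> dist x z0" using r(2)[of x z0] x z0 by (auto simp: E_def)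
      then show "h x \<in> local_maxima g - {z0}" using h[OF x] r(1) by auto
    qed
    ultimately have "card (local_maxima f) \<le> card (local_maxima g - {z0})"
      using fing by (intro card_inj_on_le) auto
    also have "\<dots> < card (local_maxima g)"
      using fing z0g by (rule card_Diff1_less)
    finally show False using cardeq by simp
  qed
  with \<open>\<epsilon> > 0\<close> show ?thesis by (intro exI[of _ \<epsilon>] conjI allI impI)
qed

section \<open>Finiteness of the extrema by the identity theorem\<close>

text \<open>At every local extremum \<open>deriv F\<close> vanishes. Infinitely many zeros on the
  compact circle would make \<open>deriv F\<close> vanish identically near it, and \<open>f\<close>
  would be constant.\<close>

lemma finite_local_extrema:
  assumes F: "F holomorphic_on U" "open U" "S1 \<subseteq> U"
    and real: "\<And>z. z \<in> S1 \<Longrightarrow> F z = of_real (f z)"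
    and nonconst: "\<not> f constant_on S1"
  shows "finite (local_maxima f)" "finite (local_minima f)"
proof -
  \<comment> \<open>The identity theorem needs a connected domain, and \<open>U\<close> may be
    disconnected; the circle lies in a single component.\<close>
  define S where "S = connected_component_set U 1"
  have S: "open S" "connected S" "S \<subseteq> U"
    using F(2) by (auto simp: S_def open_connected_component connected_component_subset)
  have "connected S1" by (rule connected_sphere) simp
  then have S1S: "S1 \<subseteq> S"
    unfolding S_def using F(3) by (intro connected_component_maximal) auto
  define F' where "F' t = \<i> * cis t * deriv F (cis t)" for t
  have vder: "((\<lambda>t. F (cis t)) has_vector_derivative F' t) (at t)" for t
  proof -
    have "(cis has_vector_derivative \<i> * cis t) (at t)"
      using has_derivative_cis[of "\<lambda>x. x" "\<lambda>x. x" t UNIV] by (simp add: has_vector_derivative_def)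
    moreover have "(F has_field_derivative deriv F (cis t)) (at (cis t))"
      using F by (intro holomorphic_derivI) auto
    ultimately show ?thesis
      unfolding F'_def using field_vector_diff_chain_at[of cis] by (fastforce simp: o_def)
  qed
  have der: "((\<lambda>t. f (cis t)) has_real_derivative Re (F' t)) (at t)" for t
    using bounded_linear.has_vector_derivative[OF bounded_linear_Re vder, of t]
    by (simp add: real has_real_derivative_iff_has_vector_derivative)
  \<comment> \<open>Since \<open>F\<close> is real on the circle, the angular derivative
    \<open>F'\<close> is real too. A critical point of the real function \<open>f\<close> is
    therefore a zero of the complex derivative.\<close>
  have "((\<lambda>t. 0) has_real_derivative Im (F' t)) (at t)" for t
    using bounded_linear.has_vector_derivative[OF bounded_linear_Im vder, of t]
    by (simp add: real has_real_derivative_iff_has_vector_derivative)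
  then have Im0: "Im (F' t) = 0" for t
    using DERIV_unique DERIV_const by blast
  have crit: "deriv F z = 0" if z: "z \<in> local_maxima f \<union> local_minima f" for z
  proof -
    have zS: "z \<in> S1" using z by (auto simp: local_maxima_def local_minima_def)
    then have zc: "cis (Arg z) = z" by (subst cis_Arg) (auto simp: sgn_div_norm)
    have "(\<forall>\<^sub>F t in at (Arg z). f (cis t) \<le> f (cis (Arg z))) \<or>
          (\<forall>\<^sub>F t in at (Arg z). f (cis (Arg z)) \<le> f (cis t))"
      using z unfolding local_maxima_def local_minima_def
      by (subst (1 2) eventually_at_S1_cis_iff[symmetric]) (auto simp: zc)
    then have "Re (F' (Arg z)) = 0"
    proof
      assume "\<forall>\<^sub>F t in at (Arg z). f (cis t) \<le> f (cis (Arg z))"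
      then obtain d where "d > 0" "\<And>t. t \<noteq> Arg z \<Longrightarrow> dist t (Arg z) < d \<Longrightarrow> f (cis t) \<le> f (cis (Arg z))"
        by (auto simp: eventually_at)
      then show ?thesis
        by (intro DERIV_local_max[OF der, of d]) (auto simp: dist_real_def abs_minus_commute, metis order_refl)
    next
      assume "\<forall>\<^sub>F t in at (Arg z). f (cis (Arg z)) \<le> f (cis t)"
      then obtain d where "d > 0" "\<And>t. t \<noteq> Arg z \<Longrightarrow> dist t (Arg z) < d \<Longrightarrow> f (cis (Arg z)) \<le> f (cis t)"
        by (auto simp: eventually_at)
      then show ?thesis
        by (intro DERIV_local_min[OF der, of d]) (auto simp: dist_real_def abs_minus_commute, metis order_refl)
    qed
    with Im0 have "F' (Arg z) = 0" by (simp add: complex_eq_iff)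
    then show ?thesis using zc zS by (auto simp: F'_def)
  qed
  have "continuous_on S1 (\<lambda>z. Re (F z))"
    using F holomorphic_on_imp_continuous_on holomorphic_on_subset by (intro continuous_intros) blast
  then have "continuous_on S1 f" by (rule continuous_on_eq) (simp add: real)
  \<comment> \<open>This one zero of \<open>deriv F\<close> shows that the derivative, if constant,
    would be zero.\<close>
  then obtain z1 where z1: "z1 \<in> local_maxima f" using local_maxima_nonempty by blast
  have "\<not> deriv F constant_on S"
  proof
    assume "deriv F constant_on S"
    then have "deriv F z = 0" if "z \<in> S" for z
      using that crit[of z1] z1 S1S by (auto simp: constant_on_def local_maxima_def)
    moreover have "cis t \<in> S" for t using S1S by (auto intro!: subsetD[OF S1S])
    ultimately have "F' t = 0" for t by (simp add: F'_def)
    then have "((\<lambda>t. f (cis t)) has_real_derivative 0) (at t)" for t using der[of t] by simp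
    then have const: "f (cis s) = f (cis t)" for s t
      using DERIV_isconst_all[of "\<lambda>t. f (cis t)"] by blast
    have "f constant_on S1"
      unfolding constant_on_def
    proof (intro exI ballI)
      fix z assume "z \<in> S1"
      then have "cis (Arg z) = z" by (subst cis_Arg) (auto simp: sgn_div_norm)
      then show "f z = f (cis 0)" using const[of "Arg z" 0] by simp
    qed
    with nonconst show False by blast
  qed
  moreover have "deriv F holomorphic_on S"
    using F S by (meson holomorphic_deriv holomorphic_on_subset)
  ultimately have "finite {z \<in> S1. deriv F z = 0}"
    using S S1S by (intro holomorphic_compact_finite_zeros[of _ S]) auto
  then show "finite (local_maxima f)" "finite (local_minima f)"
    using crit by (auto elim!: rev_finite_subset simp: local_maxima_def local_minima_def)
qed

section \<open>Cuspidal points off their normal line\<close>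

text \<open>This transports a local statement from the branch parameter to the angle. The positive
  derivative puts 0 strictly between \<open>g (- \<delta>)\<close> and \<open>g \<delta>\<close>, so
  by the intermediate value theorem every small nonzero \<open>s\<close> is \<open>g t\<close> for
  some small \<open>t\<close>, and \<open>t\<close> is nonzero because \<open>g 0 = 0\<close>. No
  inverse function is needed.\<close>

lemma eventually_at_0_image_pos:
  fixes g :: "real \<Rightarrow> real"
  assumes cont: "\<forall>\<^sub>F t in nhds 0. isCont g t" and g0: "g 0 = 0"
    and der: "(g has_real_derivative l) (at 0)" and l: "l > 0"
    and Q: "\<forall>\<^sub>F t in at 0. Q (g t)"
  shows "\<forall>\<^sub>F s in at 0. Q s"
proof -
  obtain d1 where d1: "d1 > 0" "\<And>t. \<bar>t\<bar> < d1 \<Longrightarrow> isCont g t"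
    using cont by (auto simp: eventually_nhds_metric)
  obtain d2 where d2: "d2 > 0" "\<And>t. t \<noteq> 0 \<Longrightarrow> \<bar>t\<bar> < d2 \<Longrightarrow> Q (g t)"
    using Q by (auto simp: eventually_at)
  obtain d3 where d3: "d3 > 0" "\<And>h. 0 < h \<Longrightarrow> h < d3 \<Longrightarrow> 0 < g h"
    using DERIV_pos_inc_right[OF der l] g0 by auto
  obtain d4 where d4: "d4 > 0" "\<And>h. 0 < h \<Longrightarrow> h < d4 \<Longrightarrow> g (- h) < 0"
    using DERIV_pos_inc_left[OF der l] g0 by auto
  define \<delta> where "\<delta> = min (min d1 d2) (min d3 d4) / 2"
  have \<delta>: "0 < \<delta>" "\<delta> < d1" "\<delta> < d2" "\<delta> < d3" "\<delta> < d4"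
    using d1 d2 d3 d4 by (auto simp: \<delta>_def)
  have "Q s" if "s \<noteq> 0" "g (- \<delta>) < s" "s < g \<delta>" for s
  proof -
    have "\<exists>t\<ge>- \<delta>. t \<le> \<delta> \<and> g t = s"
      using that \<delta> d1(2) by (intro IVT) auto
    then obtain t where "- \<delta> \<le> t" "t \<le> \<delta>" "g t = s" by blast
    then show ?thesis using d2(2)[of t] \<delta> g0 \<open>s \<noteq> 0\<close> by force
  qed
  then show ?thesis
    using d3(2)[of \<delta>] d4(2)[of \<delta>] \<delta>
    by (auto simp: eventually_at dist_real_def intro!: exI[of _ "min (g \<delta>) (- g (- \<delta>))"])
qed

lemma eventually_at_0_image_fps:
  fixes \<omega> :: "real \<Rightarrow> real"
  assumes \<omega>: "\<omega> has_fps_expansion A" and A: "fps_nth A 0 = 0" "fps_nth A 1 \<noteq> 0"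
    and Q: "\<forall>\<^sub>F t in at 0. Q (\<omega> t)"
  shows "\<forall>\<^sub>F s in at 0. Q s"
proof -
  define h where "h = eval_fps A"
  have rad: "fps_conv_radius A > 0" and eq: "\<forall>\<^sub>F t in nhds 0. h t = \<omega> t"
    using \<omega> by (auto simp: has_fps_expansion_def h_def)
  have "open (eball 0 (fps_conv_radius A) :: real set)" "(0::real) \<in> eball 0 (fps_conv_radius A)"
    using rad by (auto simp: zero_ereal_def)
  then have cont: "\<forall>\<^sub>F t in nhds 0. isCont h t"
    by (rule eventually_mono[OF eventually_nhds_in_open])
       (auto simp: h_def intro!: continuous_eval_fps)
  have h0: "h 0 = 0" using A by (simp add: h_def eval_fps_at_0)
  have der: "(h has_real_derivative fps_nth A 1) (at 0)"
    using has_field_derivative_eval_fps[of 0 A UNIV] rad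
    by (simp add: h_def eval_fps_at_0 zero_ereal_def)
  have "\<forall>\<^sub>F t in at 0. h t = \<omega> t" using eq by (simp add: eventually_at_filter eventually_mono)
  with Q have Qh: "\<forall>\<^sub>F t in at 0. Q (h t)" by eventually_elim simp
  show ?thesis
  proof (cases "fps_nth A 1 > 0")
    case True
    then show ?thesis using eventually_at_0_image_pos[OF cont h0 der _ Qh] by simp
  next
    case False
    \<comment> \<open>An orientation-reversing parameter is replaced by its negative, and the
      reflection is undone at the end.\<close>
    have "\<forall>\<^sub>F t in nhds 0. isCont (\<lambda>t. - h t) t"
      using cont by eventually_elim (rule continuous_minus)
    then have "\<forall>\<^sub>F s in at 0. Q (- s)"
    proof (rule eventually_at_0_image_pos[where Q = "\<lambda>s. Q (- s)"])
      show "((\<lambda>t. - h t) has_real_derivative - fps_nth A 1) (at 0)"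
        by (rule DERIV_minus[OF der])
    qed (use False A(2) h0 Qh in simp_all)
    then obtain d where d: "d > 0" "\<And>s. s \<noteq> 0 \<Longrightarrow> \<bar>s\<bar> < d \<Longrightarrow> Q (- s)"
      by (auto simp: eventually_at)
    have "Q s" if "s \<noteq> 0" "\<bar>s\<bar> < d" for s
      using d(2)[of "- s"] that by simp
    with d(1) show ?thesis by (auto simp: eventually_at)
  qed
qed

text \<open>The quotient has the shifted series as its expansion, whose constant term
  \<open>fps_nth B p\<close> is 0; continuity at 0 gives the limit. The zero series is treated apart
  because its \<open>subdegree\<close> is 0 by convention.\<close>

lemma fps_tail_over_power_tendsto_0:
  fixes \<sigma> :: "real \<Rightarrow> real"
  assumes \<sigma>: "\<sigma> has_fps_expansion B" and B: "\<And>n. n \<le> p \<Longrightarrow> fps_nth B n = 0"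
  shows "((\<lambda>t. \<sigma> t / t ^ p) \<longlongrightarrow> 0) (at 0)"
proof (cases "B = 0")
  case True
  then have "\<forall>\<^sub>F t in at 0. \<sigma> t / t ^ p = 0"
    using \<sigma> by (auto simp: has_fps_expansion_def eventually_at_filter elim!: eventually_mono)
  then show ?thesis by (rule tendsto_eventually)
next
  case False
  then have "p \<le> subdegree B" using B by (intro subdegree_geI) auto
  then have "(\<lambda>t. if t = 0 then 0 else \<sigma> t / t ^ p) has_fps_expansion fps_shift p B"
    using \<sigma> B by (intro has_fps_expansion_shift) auto
  then have "isCont (\<lambda>t. if t = 0 then 0 else \<sigma> t / t ^ p) 0"
    by (rule has_fps_expansion_imp_continuous)
  then have "((\<lambda>t. if t = 0 then 0 else \<sigma> t / t ^ p) \<longlongrightarrow> 0) (at 0)"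
    by (simp add: isCont_def)
  then show ?thesis
    by (rule Lim_transform_eventually) (simp add: eventually_at_filter)
qed

text \<open>Off the normal line of an even branch, the squared distance has leading term
  \<open>2 ((\<gamma> z - v) \<bullet> e\<^sub>1) t\<^sup>p\<close> with \<open>p\<close> even.\<close>

lemma cuspidal_point_extremum:
  assumes z: "z \<in> cuspidal_points \<gamma>"
  obtains e :: "real^2" where "norm e = 1"
    and "\<And>v. (\<gamma> z - v) \<bullet> e \<noteq> 0 \<Longrightarrow> z \<in> maxima \<gamma> v \<union> minima \<gamma> v"
proof -
  obtain p q c where zS: "z \<in> S1" and bf: "branch_form \<gamma> z p q c" and p: "even p"
    using z by (auto simp: cuspidal_points_def)
  obtain e1 e2 :: "real^2" and \<omega> A \<sigma> B where
    e: "norm e1 = 1" "norm e2 = 1" "e1 \<bullet> e2 = 0"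
    and \<omega>: "\<omega> has_fps_expansion A" "fps_nth A 0 = 0" "fps_nth A 1 \<noteq> 0"
    and \<sigma>: "\<sigma> has_fps_expansion B" "\<And>n. n \<le> q \<Longrightarrow> fps_nth B n = 0"
    and \<gamma>: "\<forall>\<^sub>F t in nhds 0. \<gamma> (z * cis (\<omega> t)) =
            \<gamma> z + t ^ p *\<^sub>R e1 + (c * t ^ q + \<sigma> t) *\<^sub>R e2"
    and pq: "1 \<le> p" "p < q"
    using bf unfolding branch_form_def by auto
  have "z \<in> maxima \<gamma> v \<union> minima \<gamma> v" if k: "(\<gamma> z - v) \<bullet> e1 \<noteq> 0" for v
  proof -
    define f where "f = sq_dist v \<circ> \<gamma>"
    define k where "k = (\<gamma> z - v) \<bullet> e1"
    define a where "a = (\<gamma> z - v) \<bullet> e2"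
    \<comment> \<open>The displacement along \<open>e2\<close> is \<open>t ^ p * \<rho> t\<close>
      with \<open>\<rho>\<close> tending to 0. Expanding the square, the increment of
      \<open>f\<close> is \<open>t ^ p * h t\<close>, and \<open>h\<close> tends to
      \<open>2 * k\<close>, which is nonzero off the normal line.\<close>
    define \<rho> where "\<rho> t = c * t ^ (q - p) + \<sigma> t / t ^ p" for t
    define h where "h t = 2 * k + 2 * a * \<rho> t + t ^ p + t ^ p * (\<rho> t)\<^sup>2" for t
    have "((\<lambda>t. \<sigma> t / t ^ p) \<longlongrightarrow> 0) (at 0)"
      using \<sigma> pq by (intro fps_tail_over_power_tendsto_0) auto
    then have "(\<rho> \<longlongrightarrow> c * 0 ^ (q - p) + 0) (at 0)"
      unfolding \<rho>_def by (intro tendsto_intros)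
    then have "(\<rho> \<longlongrightarrow> 0) (at 0)" using pq by (simp add: power_0_left)
    then have "(h \<longlongrightarrow> 2 * k + 2 * a * 0 + 0 ^ p + 0 ^ p * 0\<^sup>2) (at 0)"
      unfolding h_def by (intro tendsto_intros)
    then have h: "(h \<longlongrightarrow> 2 * k) (at 0)" using pq by (simp add: power_0_left)
    have "\<forall>\<^sub>F t in at 0. t \<noteq> 0 \<and> \<gamma> (z * cis (\<omega> t)) =
            \<gamma> z + t ^ p *\<^sub>R e1 + (c * t ^ q + \<sigma> t) *\<^sub>R e2"
      using \<gamma> by (simp add: eventually_at_filter eventually_mono)
    then have fh: "\<forall>\<^sub>F t in at 0. 0 < t ^ p \<and> f (z * cis (\<omega> t)) = f z + t ^ p * h t"
    proof eventually_elim
      case (elim t)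
      define x where "x = t ^ p"
      \<comment> \<open>Here the evenness of \<open>p\<close> enters: the factor
        \<open>t ^ p\<close> is positive on both sides of 0, so the increment has the sign of
        \<open>k\<close>.\<close>
      have tp: "x > 0" using p elim by (simp add: x_def zero_less_power_eq)
      have "t ^ q = x * t ^ (q - p)" using pq by (simp add: x_def flip: power_add)
      then have \<tau>: "c * t ^ q + \<sigma> t = x * \<rho> t"
        using tp by (simp add: \<rho>_def field_simps flip: x_def)
      have "f (z * cis (\<omega> t)) = (norm ((\<gamma> z - v) + (x *\<^sub>R e1 + (x * \<rho> t) *\<^sub>R e2)))\<^sup>2"
        using elim by (simp add: f_def sq_dist_def \<tau> add_diff_eq diff_add_eq add.assoc del: scaleR_left_distrib flip: x_def)
      also have "\<dots> = f z + 2 * (x * k + x * \<rho> t * a) + (x\<^sup>2 + (x * \<rho> t)\<^sup>2)"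
        unfolding f_def sq_dist_def k_def a_def comp_def power2_norm_eq_inner inner_add_left inner_add_right inner_scaleR_left inner_scaleR_right
        using e by (simp add: norm_eq_1 inner_commute power2_eq_square algebra_simps)
      also have "\<dots> = f z + x * h t"
        by (simp add: h_def power2_eq_square algebra_simps flip: x_def)
      finally show ?case using tp by (simp add: x_def)
    qed
    show ?thesis
    proof (cases "k > 0")
      case True
      then have "\<forall>\<^sub>F t in at 0. h t > 0" using h by (intro order_tendstoD[of h "2 * k"]) auto
      with fh have "\<forall>\<^sub>F t in at 0. f z \<le> f (z * cis (\<omega> t))"
        by eventually_elim simp
      then have "\<forall>\<^sub>F s in at 0. f z \<le> f (z * cis s)"
        by (rule eventually_at_0_image_fps[OF \<omega>])
      then show ?thesis
        using zS by (simp add: minima_def local_minima_def eventually_at_S1_iff flip: f_def)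
    next
      case False
      then have "k < 0" using k by (simp add: k_def)
      then have "\<forall>\<^sub>F t in at 0. h t < 0" using h by (intro order_tendstoD[of h "2 * k"]) auto
      with fh have "\<forall>\<^sub>F t in at 0. f (z * cis (\<omega> t)) \<le> f z"
        by eventually_elim (simp add: mult_nonneg_nonpos)
      then have "\<forall>\<^sub>F s in at 0. f (z * cis s) \<le> f z"
        by (rule eventually_at_0_image_fps[OF \<omega>])
      then show ?thesis
        using zS by (simp add: maxima_def local_maxima_def eventually_at_S1_iff flip: f_def)
    qed
  qed
  with e(1) show thesis by (rule that)
qed

section \<open>The family of squared distances along the curve\<close>

text \<open>The curve is bounded by compactness. Factoring the difference of two squared norms
  bounds it uniformly by \<open>D v\<close>, which is continuous in \<open>v\<close> and vanishes at
  \<open>u\<close>.\<close>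

lemma sq_dist_uniformly_close:
  assumes \<gamma>: "continuous_on S1 \<gamma>" and \<epsilon>: "\<epsilon> > 0"
  shows "\<forall>\<^sub>F v in nhds u. \<forall>z\<in>S1. \<bar>(sq_dist v \<circ> \<gamma>) z - (sq_dist u \<circ> \<gamma>) z\<bar> < \<epsilon>"
proof -
  have "bounded (\<gamma> ` S1)"
    by (rule compact_imp_bounded[OF compact_continuous_image[OF \<gamma> compact_sphere]])
  then obtain C where C: "C > 0" "\<And>z. z \<in> S1 \<Longrightarrow> norm (\<gamma> z) \<le> C"
    unfolding bounded_pos by blast
  define D where "D v = dist v u * (2 * C + norm v + norm u)" for v
  have "isCont D u"
    unfolding D_def by (intro continuous_intros)
  then have "(D \<longlongrightarrow> D u) (nhds u)"
    by (simp only: isCont_def tendsto_at_iff_tendsto_nhds)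
  then have "\<forall>\<^sub>F v in nhds u. D v < \<epsilon>"
    using \<epsilon> by (intro order_tendstoD[of D "D u"]) (auto simp: D_def)
  then show ?thesis
  proof eventually_elim
    case (elim v)
    show ?case
    proof
      fix z assume z: "z \<in> S1"
      define x y where "x = norm (\<gamma> z - v)" and "y = norm (\<gamma> z - u)"
      have "\<bar>(sq_dist v \<circ> \<gamma>) z - (sq_dist u \<circ> \<gamma>) z\<bar> = \<bar>x - y\<bar> * (x + y)"
        by (simp add: sq_dist_def square_diff_square_factored power2_eq_square abs_mult x_def y_def)
      also have "\<dots> \<le> dist v u * (2 * C + norm v + norm u)"
      proof (rule mult_mono)
        show "\<bar>x - y\<bar> \<le> dist v u"
          using norm_triangle_ineq3[of "\<gamma> z - v" "\<gamma> z - u"] 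
          by (simp add: x_def y_def dist_norm norm_minus_commute)
        show "x + y \<le> 2 * C + norm v + norm u"
          using norm_triangle_ineq4[of "\<gamma> z" v] norm_triangle_ineq4[of "\<gamma> z" u] C(2)[OF z]
          by (simp add: x_def y_def)
      qed (auto simp: x_def y_def)
      finally show "\<bar>(sq_dist v \<circ> \<gamma>) z - (sq_dist u \<circ> \<gamma>) z\<bar> < \<epsilon>" using elim by (simp add: D_def)
    qed
  qed
qed

lemma normalized_by_circle_analytic:
  assumes "normalized_by_circle P \<gamma>"
  obtains U F where "open U" "S1 \<subseteq> U" "\<And>v. F v holomorphic_on U"
    and "\<And>v z. z \<in> S1 \<Longrightarrow> F v z = of_real ((sq_dist v \<circ> \<gamma>) z)"
    and "continuous_on S1 \<gamma>" and "\<not> \<gamma> constant_on S1"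
proof -
  obtain W U and \<Gamma> :: "complex \<Rightarrow> complex^2" where
    \<Gamma>P: "is_normalization P W U \<Gamma>" and U: "S1 \<subseteq> U"
    and \<Gamma>: "\<And>z. z \<in> S1 \<Longrightarrow> \<Gamma> z = complexify (\<gamma> z)"
    using assms unfolding normalized_by_circle_def by blast
  have "open U" and hol: "\<And>i. (\<lambda>z. \<Gamma> z $ i) holomorphic_on U"
    and "\<exists>S. finite S \<and> inj_on \<Gamma> (U - S)"
    using \<Gamma>P unfolding is_normalization_def by simp_all
  then obtain S where S: "finite S" "inj_on \<Gamma> (U - S)" by blast
  \<comment> \<open>The squares are taken without absolute values, which keeps \<open>F v\<close>
    holomorphic; on the circle \<open>\<Gamma>\<close> has real coordinates, and the sum is the
    Euclidean squared distance.\<close>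
  define F where "F v z = (\<Sum>i\<in>UNIV. (\<Gamma> z $ i - of_real (v $ i))\<^sup>2)" for v :: "real^2" and z
  have "F v holomorphic_on U" for v
    unfolding F_def by (intro holomorphic_intros hol)
  moreover have "F v z = of_real ((sq_dist v \<circ> \<gamma>) z)" if "z \<in> S1" for v z
  proof -
    have "(norm (\<gamma> z - v))\<^sup>2 = (\<Sum>i\<in>UNIV. (\<gamma> z $ i - v $ i)\<^sup>2)"
      by (simp add: power2_norm_eq_inner inner_vec_def flip: power2_eq_square)
    then show ?thesis
      using \<Gamma>[OF that] by (simp add: F_def sq_dist_def complexify_def)
  qed
  moreover have "continuous_on S1 \<gamma>"
  proof -
    have "continuous_on S1 (\<lambda>z. Re (\<Gamma> z $ i))" for i
      by (rule continuous_on_Re, rule holomorphic_on_imp_continuous_on,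
          rule holomorphic_on_subset[OF hol U])
    then have "continuous_on S1 (\<lambda>z. \<chi> i. Re (\<Gamma> z $ i))"
      by (rule continuous_on_vec_lambda)
    then show ?thesis
      by (rule continuous_on_eq) (simp add: \<Gamma> complexify_def vec_eq_iff)
  qed
  moreover have "\<not> \<gamma> constant_on S1"
  proof
    assume "\<gamma> constant_on S1"
    then obtain y where y: "\<And>z. z \<in> S1 \<Longrightarrow> \<gamma> z = y" by (auto simp: constant_on_def)
    \<comment> \<open>Generic injectivity of the normalization excludes a constant
      \<open>\<gamma>\<close>: infinitely many points of the circle would share one image.\<close>
    have "inj_on \<Gamma> (S1 - S)" using S(2) U by (elim inj_on_subset) blast
    moreover have "\<Gamma> ` (S1 - S) \<subseteq> {complexify y}" using \<Gamma> y by auto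
    ultimately have "finite (S1 - S)" by (meson finite.emptyI finite.insertI inj_on_finite)
    then show False using S(1) infinite_S1 by simp
  qed
  ultimately show thesis using that[of U F] \<open>open U\<close> U by blast
qed

section \<open>Consequences of topological stability\<close>

text \<open>For a constant distance every point of the circle is a local maximum, so there are
  infinitely many. An arbitrarily small shift of the centre along a chord leaves only finitely many,
  against stability.\<close>

lemma stable_not_constant:
  assumes norm: "normalized_by_circle P \<gamma>" and stable: "topologically_stable \<gamma> u"
  shows "\<not> (sq_dist u \<circ> \<gamma>) constant_on S1"
proof
  assume const: "(sq_dist u \<circ> \<gamma>) constant_on S1"
  obtain U F where U: "open U" "S1 \<subseteq> U" "\<And>v. F v holomorphic_on U"
    and F: "\<And>v z. z \<in> S1 \<Longrightarrow> F v z = of_real ((sq_dist v \<circ> \<gamma>) z)"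
    and nonconst: "\<not> \<gamma> constant_on S1"
    using normalized_by_circle_analytic[OF norm] by metis
  obtain z where z: "z \<in> S1" "\<gamma> z \<noteq> \<gamma> 1"
    using nonconst unfolding constant_on_def by blast
  define d where "d = \<gamma> z - \<gamma> 1"
  have "\<forall>\<^sub>F v in nhds u. local_maxima (sq_dist v \<circ> \<gamma>) \<approx> local_maxima (sq_dist u \<circ> \<gamma>)"
    using stable by (auto simp: topologically_stable_def topologically_equivalent_def elim: eventually_mono)
  moreover have "((\<lambda>s. u + s *\<^sub>R d) \<longlongrightarrow> u + 0 *\<^sub>R d) (at 0)"
    by (intro tendsto_intros)
  ultimately have "\<forall>\<^sub>F s in at 0. local_maxima (sq_dist (u + s *\<^sub>R d) \<circ> \<gamma>) \<approx> local_maxima (sq_dist u \<circ> \<gamma>)"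
    by (auto dest: eventually_compose_filterlim)
  moreover have "\<forall>\<^sub>F s in at (0::real). s \<noteq> 0"
    by (simp add: eventually_at_filter)
  ultimately have "\<forall>\<^sub>F s in at 0. s \<noteq> 0 \<and> local_maxima (sq_dist (u + s *\<^sub>R d) \<circ> \<gamma>) \<approx> local_maxima (sq_dist u \<circ> \<gamma>)"
    by eventually_elim simp
  then obtain s where s: "s \<noteq> 0"
    and eqp: "local_maxima (sq_dist (u + s *\<^sub>R d) \<circ> \<gamma>) \<approx> local_maxima (sq_dist u \<circ> \<gamma>)"
    using eventually_happens'[OF at_neq_bot] by blast
  \<comment> \<open>In the difference of the two distances the terms quadratic in \<open>s\<close>
    cancel. What remains is linear in \<open>s\<close> with slope
    \<open>- 2 * (d \<bullet> d)\<close>, nonzero because the ends of the chord differ.\<close>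
  have "sq_dist (u + s *\<^sub>R d) (\<gamma> z) - sq_dist (u + s *\<^sub>R d) (\<gamma> 1) =
      sq_dist u (\<gamma> z) - sq_dist u (\<gamma> 1) - 2 * s * (d \<bullet> d)"
    by (simp add: sq_dist_def d_def power2_norm_eq_inner inner_diff_left inner_diff_right
        inner_add_left inner_add_right inner_commute algebra_simps)
  also have "sq_dist u (\<gamma> z) = sq_dist u (\<gamma> 1)"
    using const z(1) by (auto simp: constant_on_def)
  finally have "sq_dist (u + s *\<^sub>R d) (\<gamma> z) \<noteq> sq_dist (u + s *\<^sub>R d) (\<gamma> 1)"
    using s z(2) by (auto simp: d_def)
  then have "\<not> (sq_dist (u + s *\<^sub>R d) \<circ> \<gamma>) constant_on S1"
    using z(1) by (force simp: constant_on_def)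
  then have "finite (local_maxima (sq_dist (u + s *\<^sub>R d) \<circ> \<gamma>))"
    by (intro finite_local_extrema[OF U(3,1,2) F])
  then have "finite (local_maxima (sq_dist u \<circ> \<gamma>))"
    using eqp eqpoll_finite_iff by blast
  moreover have "local_maxima (sq_dist u \<circ> \<gamma>) = S1"
  proof -
    obtain k where "\<And>w. w \<in> S1 \<Longrightarrow> (sq_dist u \<circ> \<gamma>) w = k"
      using const unfolding constant_on_def by blast
    then show ?thesis
      unfolding local_maxima_def eventually_at_filter by auto
  qed
  ultimately show False using infinite_S1 by simp
qed

lemma continuous_on_sq_dist:
  assumes "continuous_on S1 \<gamma>"
  shows "continuous_on S1 (sq_dist v \<circ> \<gamma>)"
  unfolding sq_dist_def comp_def by (intro continuous_intros assms)

text \<open>Near \<open>u\<close> the functions are uniformly close, so a new maximum at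
  \<open>z\<close> would change the number of maxima, which stability keeps fixed.\<close>

lemma eventually_not_new_local_maximum:
  assumes \<gamma>: "continuous_on S1 \<gamma>" and fin: "finite (maxima \<gamma> u)" and z: "z \<notin> maxima \<gamma> u"
    and stable: "topologically_stable \<gamma> u"
  shows "\<forall>\<^sub>F v in nhds u. z \<notin> maxima \<gamma> v"
proof -
  obtain \<epsilon> where "\<epsilon> > 0" and \<epsilon>: "\<And>g. continuous_on S1 g \<Longrightarrow>
      \<forall>w\<in>S1. \<bar>g w - (sq_dist u \<circ> \<gamma>) w\<bar> < \<epsilon> \<Longrightarrow> z \<in> local_maxima g \<Longrightarrow>
      \<not> local_maxima g \<approx> local_maxima (sq_dist u \<circ> \<gamma>)"
    using new_local_maximum_not_eqpoll[OF continuous_on_sq_dist[OF \<gamma>], of u z] fin z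
    unfolding maxima_def by blast
  then have "\<forall>\<^sub>F v in nhds u. \<forall>w\<in>S1. \<bar>(sq_dist v \<circ> \<gamma>) w - (sq_dist u \<circ> \<gamma>) w\<bar> < \<epsilon>"
    using sq_dist_uniformly_close[OF \<gamma>] by blast
  with stable[unfolded topologically_stable_def] show ?thesis
    by eventually_elim
       (use \<epsilon> continuous_on_sq_dist[OF \<gamma>] in \<open>auto simp: maxima_def topologically_equivalent_def\<close>)
qed

lemma eventually_not_new_local_minimum:
  assumes \<gamma>: "continuous_on S1 \<gamma>" and fin: "finite (minima \<gamma> u)" and z: "z \<notin> minima \<gamma> u"
    and stable: "topologically_stable \<gamma> u"
  shows "\<forall>\<^sub>F v in nhds u. z \<notin> minima \<gamma> v"
proof -
  \<comment> \<open>Minima are handled as maxima of the negated functions; negation does not affect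
    uniform closeness.\<close>
  have "continuous_on S1 (\<lambda>w. - (sq_dist u \<circ> \<gamma>) w)"
    by (intro continuous_on_minus continuous_on_sq_dist \<gamma>)
  then obtain \<epsilon> where "\<epsilon> > 0" and \<epsilon>: "\<And>g. continuous_on S1 g \<Longrightarrow>
      \<forall>w\<in>S1. \<bar>g w - - (sq_dist u \<circ> \<gamma>) w\<bar> < \<epsilon> \<Longrightarrow> z \<in> local_maxima g \<Longrightarrow>
      \<not> local_maxima g \<approx> local_minima (sq_dist u \<circ> \<gamma>)"
    using new_local_maximum_not_eqpoll[of "\<lambda>w. - (sq_dist u \<circ> \<gamma>) w" z] fin z
    unfolding minima_def local_maxima_uminus by blast
  then have "\<forall>\<^sub>F v in nhds u. \<forall>w\<in>S1. \<bar>(sq_dist v \<circ> \<gamma>) w - (sq_dist u \<circ> \<gamma>) w\<bar> < \<epsilon>"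
    using sq_dist_uniformly_close[OF \<gamma>] by blast
  with stable[unfolded topologically_stable_def] show ?thesis
  proof eventually_elim
    case (elim v)
    define g where "g = sq_dist v \<circ> \<gamma>"
    have "continuous_on S1 (\<lambda>w. - g w)"
      unfolding g_def by (intro continuous_on_minus continuous_on_sq_dist \<gamma>)
    moreover have "\<forall>w\<in>S1. \<bar>- g w - - (sq_dist u \<circ> \<gamma>) w\<bar> < \<epsilon>"
      using elim(2) by (simp add: g_def abs_minus_commute)
    ultimately have "z \<in> local_maxima (\<lambda>w. - g w) \<Longrightarrow>
        \<not> local_maxima (\<lambda>w. - g w) \<approx> local_minima (sq_dist u \<circ> \<gamma>)"
      by (rule \<epsilon>)
    then have "z \<in> local_minima g \<Longrightarrow> \<not> local_minima g \<approx> local_minima (sq_dist u \<circ> \<gamma>)"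
      unfolding local_maxima_uminus .
    with elim(1) show ?case
      by (auto simp: minima_def topologically_equivalent_def g_def)
  qed
qed

text \<open>Only a \<open>u\<close> on the normal line of the branch is in question. Moving it along
  the tangent direction \<open>e\<close> leaves that line at once, so \<open>z\<close> is extremal
  for centres arbitrarily close to \<open>u\<close>, whereas stability keeps a non-extremal point
  non-extremal nearby.\<close>

lemma cuspidal_points_subset_critical_points:
  assumes \<gamma>: "continuous_on S1 \<gamma>"
    and fin: "finite (maxima \<gamma> u)" "finite (minima \<gamma> u)"
    and stable: "topologically_stable \<gamma> u"
  shows "cuspidal_points \<gamma> \<subseteq> critical_points \<gamma> u"
proof
  fix z assume "z \<in> cuspidal_points \<gamma>"
  then obtain e :: "real^2" where e: "norm e = 1"
    and ext: "\<And>v. (\<gamma> z - v) \<bullet> e \<noteq> 0 \<Longrightarrow> z \<in> maxima \<gamma> v \<union> minima \<gamma> v"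
    using cuspidal_point_extremum by blast
  show "z \<in> critical_points \<gamma> u"
  proof (rule ccontr)
    assume "z \<notin> critical_points \<gamma> u"
    then have nmax: "z \<notin> maxima \<gamma> u" and nmin: "z \<notin> minima \<gamma> u"
      by (auto simp: critical_points_def)
    then have on_normal: "(\<gamma> z - u) \<bullet> e = 0" using ext by blast
    have "\<forall>\<^sub>F v in nhds u. z \<notin> maxima \<gamma> v \<union> minima \<gamma> v"
      using eventually_not_new_local_maximum[OF \<gamma> fin(1) nmax stable]
        eventually_not_new_local_minimum[OF \<gamma> fin(2) nmin stable]
      by eventually_elim simp
    moreover have "((\<lambda>s. u + s *\<^sub>R e) \<longlongrightarrow> u + 0 *\<^sub>R e) (at 0)"
      by (intro tendsto_intros)
    ultimately have "\<forall>\<^sub>F s in at 0. z \<notin> maxima \<gamma> (u + s *\<^sub>R e) \<union> minima \<gamma> (u + s *\<^sub>R e)"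
      by (auto dest: eventually_compose_filterlim)
    moreover have "\<forall>\<^sub>F s in at (0::real). s \<noteq> 0"
      by (simp add: eventually_at_filter)
    ultimately have "\<forall>\<^sub>F s in at (0::real). False"
    proof eventually_elim
      case (elim s)
      have "(\<gamma> z - (u + s *\<^sub>R e)) \<bullet> e = - s"
        using on_normal e by (simp add: inner_diff_left inner_add_left norm_eq_1)
      with elim ext show ?case by force
    qed
    then show False by simp
  qed
qed

section \<open>Counting the normals\<close>

theorem proposition5:
  fixes X :: "(real^2) set" and P :: "real poly poly"
    and \<gamma> :: "complex \<Rightarrow> real^2" and u :: "real^2"
  assumes "squarefree P" and "X = zero_locus P" and "compact X"
    and "normalized_by_circle P \<gamma>"
    and "u \<notin> tED_discriminant \<gamma>"
  defines "N \<equiv> card (critical_points \<gamma> u)"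
    and "M \<equiv> card (maxima \<gamma> u)"
    and "m \<equiv> card (minima \<gamma> u)"
    and "M\<^sub>c \<equiv> card (maxima \<gamma> u \<inter> cuspidal_points \<gamma>)"
    and "m\<^sub>c \<equiv> card (minima \<gamma> u \<inter> cuspidal_points \<gamma>)"
    and "N\<^sub>c \<equiv> card (cuspidal_points \<gamma>)"
  shows "finite (critical_points \<gamma> u) \<and> finite (cuspidal_points \<gamma>) \<and>
    (N = M + m \<and> M + m \<ge> 2) \<and>
    (m = M \<and> M \<ge> 1) \<and>
    (int N \<ge> int M\<^sub>c + int m\<^sub>c + \<bar>int M\<^sub>c - int m\<^sub>c\<bar> \<and>
     int M\<^sub>c + int m\<^sub>c + \<bar>int M\<^sub>c - int m\<^sub>c\<bar> \<ge> int N\<^sub>c)"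
proof -
  have stable: "topologically_stable \<gamma> u"
    using assms(5) by (simp add: tED_discriminant_def)
  obtain U F where U: "open U" "S1 \<subseteq> U" "\<And>v. F v holomorphic_on U"
    and F: "\<And>v z. z \<in> S1 \<Longrightarrow> F v z = of_real ((sq_dist v \<circ> \<gamma>) z)"
    and \<gamma>: "continuous_on S1 \<gamma>"
    using normalized_by_circle_analytic[OF assms(4)] by metis
  have fin: "finite (maxima \<gamma> u)" "finite (minima \<gamma> u)"
    using finite_local_extrema[OF U(3,1,2) F stable_not_constant[OF assms(4) stable]]
    by (simp_all add: maxima_def minima_def)
  then have finN: "finite (critical_points \<gamma> u)" by (simp add: critical_points_def)
  have cusp: "cuspidal_points \<gamma> \<subseteq> critical_points \<gamma> u"
    using \<gamma> fin stable by (rule cuspidal_points_subset_critical_points)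
  then have finc: "finite (cuspidal_points \<gamma>)" using finN by (rule finite_subset)
  have disj: "maxima \<gamma> u \<inter> minima \<gamma> u = {}"
    using fin(1) local_maxima_inter_local_minima by (simp add: maxima_def minima_def)
  have N: "N = M + m"
    unfolding N_def M_def m_def critical_points_def using fin disj by (intro card_Un_disjoint)
  have mM: "m = M"
    unfolding M_def m_def maxima_def minima_def
    using card_local_maxima_eq_card_local_minima[OF continuous_on_sq_dist[OF \<gamma>]] fin
    by (simp add: maxima_def minima_def)
  have M1: "M \<ge> 1"
    using fin(1) local_maxima_nonempty[OF continuous_on_sq_dist[OF \<gamma>]]
    by (simp add: M_def maxima_def Suc_le_eq card_gt_0_iff)
  have "M\<^sub>c \<le> M" "m\<^sub>c \<le> m"
    unfolding M\<^sub>c_def m\<^sub>c_def M_def m_def using fin by (auto intro: card_mono)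
  moreover have "N\<^sub>c = M\<^sub>c + m\<^sub>c"
  proof -
    have "cuspidal_points \<gamma> = (maxima \<gamma> u \<inter> cuspidal_points \<gamma>) \<union> (minima \<gamma> u \<inter> cuspidal_points \<gamma>)"
      using cusp by (auto simp: critical_points_def)
    moreover have "card \<dots> = M\<^sub>c + m\<^sub>c"
      unfolding M\<^sub>c_def m\<^sub>c_def using finc disj by (intro card_Un_disjoint) auto
    ultimately show ?thesis by (simp add: N\<^sub>c_def)
  qed
  \<comment> \<open>The middle term is twice the larger of \<open>M\<^sub>c\<close> and
    \<open>m\<^sub>c\<close>. It is at most \<open>2 * M\<close>, which equals \<open>N\<close>, and
    at least the sum \<open>M\<^sub>c + m\<^sub>c\<close>, which equals
    \<open>N\<^sub>c\<close>.\<close>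
  ultimately show ?thesis
    using finN finc N mM M1 by auto
qed

end
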